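(* Let $\Omega=(0,1)\times(0,1)$, $\sigma>0$, $0<w<1/2$. There exists a constant $C>0$, depending on $\sigma,w$ (but not on $h$), such that, for all sufficiently small $h=1/n$, $$\|(\mathcal{K}^{\sigma,w}-\mathcal{K}_h)u\|\le C\,h\,\|u\|,\qquad \forall u\in\mathcal{U}_h,$$ $$\|\mathcal{K}_hu\|_{L^\infty(\Omega)}\le C\,\|u\|,\qquad \forall u\in\mathcal{U}_h.$$
   Context: $|x|$ is the Euclidean norm on $\mathbb{R}^2$, $|x|_\infty=\max(|x_1|,|x_2|)$; $\|\cdot\|$ is the $L^2(\Omega)$-norm (with respect to the normalized measure $dm_2(x)=(2\pi)^{-1}dx$). $G_\sigma(x)=\sigma^{-2}e^{-|x|^2/(2\sigma^2)}$ and, for $w>0$, $\alpha_w=\frac{1}{2\pi}\int_{|x|_\infty<w}G_\sigma(x)\,dx$. The restricted Gaussian blurring operator is $$\mathcal{K}^{\sigma,w}u(x)=\frac{\alpha_w^{-1}}{2\pi}\int_{|x-y|_\infty<w}G_\sigma(x-y)u(y)\,dy;$$ for $u\in L^2(\Omega)$, $u$ is extended by zero outside $\Omega$ and $\mathcal{K}^{\sigma,w}u$ is restricted to $\Omega$. Discretization. For $n\in\mathbb{N}$, $n\ge 1$, $h=1/n$, $\Omega$ is partitioned uniformly into $N_h=n^2$ squares $R_k$ of side $h$ with centers $z_k$; the grid is extended to all of $\mathbb{R}^2$. $\mathcal{U}_h$ is the space of functions on $\Omega$ that are constant on each $R_k$, identified with their values $u(z_k)$ and extended by zero outside $\Omega$.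 For $r>0$ let $\mathcal{B}_r(z)=\{y\in\mathbb{R}^2:|y-z|_\infty<r\}$. For each node $z_k$, $\mathcal{N}_k$ is the set of indices $l$ such that the interior of $R_l$ intersects $\mathcal{B}_w(z_k)$, i.e. $|z_k-z_l|_\infty<w+h/2$; the union of the $R_l$, $l\in\mathcal{N}_k$, is (up to closure) $\mathcal{B}_{w_h}(z_k)$ with $w_h=\left(\left\lceil\frac{w}{h}-\frac12\right\rceil+\frac12\right)h$. The operator $\mathcal{K}_h:\mathcal{U}_h\to\mathcal{U}_h$ is defined by $$(\mathcal{K}_hu)(z_k)=(1+\eta)\sum_{l\in\mathcal{N}_k}\gamma_{kl}\,u(z_l),\qquad\gamma_{kl}=\frac{h^2}{2\pi\alpha_{w_h}}G_\sigma(z_k-z_l),$$ where the number $\eta$ (independent of $k$) is chosen so that $(1+\eta)\sum_{l\in\mathcal{N}_k}\gamma_{kl}=1$ for all $1\le k\le N_h$ with $\mathcal{B}_{w_h}(z_k)\subseteq\Omega$ (by uniformity of the grid this sum is the same for all such $k$; such $k$ exist for $h$ small). *)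

theory Defs
  imports "HOL-Analysis.Analysis" "HOL-Probability.Essential_Supremum"
begin

text \<open>
  The library's \<^const>\<open>infnorm\<close> is the maximum norm on \<^typ>\<open>real^2\<close>, see the lemma \<open>infnorm_2\<close>.
  The measure underlying all integrals and norms is the normalized one, Lebesgue measure divided by
  \<open>2 * pi\<close>; the factor is written out. The mesh size is \<open>h = 1 / real n\<close>.
\<close>

definition Omega :: "(real^2) set" where
  "Omega = {x. 0 < x $ 1 \<and> x $ 1 < 1 \<and> 0 < x $ 2 \<and> x $ 2 < 1}"

definition sq_ball :: "real \<Rightarrow> real^2 \<Rightarrow> (real^2) set" where
  "sq_ball r z = {y. infnorm (y - z) < r}"

definition L2_norm_Omega :: "(real^2 \<Rightarrow> real) \<Rightarrow> real" where
  "L2_norm_Omega u = sqrt (1 / (2 * pi) * (LINT x:Omega|lborel. (u x)\<^sup>2))"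

definition Linf_norm_Omega :: "(real^2 \<Rightarrow> real) \<Rightarrow> ereal" where
  "Linf_norm_Omega u = esssup (restrict_space lborel Omega) (\<lambda>x. ereal \<bar>u x\<bar>)"

definition gauss :: "real \<Rightarrow> real^2 \<Rightarrow> real" where
  "gauss \<sigma> x = 1 / \<sigma>\<^sup>2 * exp (- (norm x)\<^sup>2 / (2 * \<sigma>\<^sup>2))"

definition alpha :: "real \<Rightarrow> real \<Rightarrow> real" where
  "alpha \<sigma> w = 1 / (2 * pi) * (LINT x:sq_ball w 0|lborel. gauss \<sigma> x)"

text \<open>
  The operator acts on functions on the plane. For an operator on functions on \<^const>\<open>Omega\<close>,
  the argument must vanish outside \<^const>\<open>Omega\<close>, and the values outside are disregarded.
\<close>

definition blur :: "real \<Rightarrow> real \<Rightarrow> (real^2 \<Rightarrow> real) \<Rightarrow> real^2 \<Rightarrow> real" where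
  "blur \<sigma> w u x =
     inverse (alpha \<sigma> w) / (2 * pi) * (LINT y:sq_ball w x|lborel. gauss \<sigma> (x - y) * u y)"

text \<open>
  Squares of the grid are indexed by pairs of integers; those in \<^term>\<open>grid n\<close> cover \<^const>\<open>Omega\<close>.
  Taking them half-open makes the partition exact. Step functions are exactly zero outside
  \<^const>\<open>Omega\<close>, also on the part of its boundary that is contained in some square.
\<close>

definition grid :: "nat \<Rightarrow> (int \<times> int) set" where
  "grid n = {0..<int n} \<times> {0..<int n}"

definition cell :: "nat \<Rightarrow> int \<times> int \<Rightarrow> (real^2) set" where
  "cell n k = {x. of_int (fst k) / real n \<le> x $ 1 \<and> x $ 1 < (of_int (fst k) + 1) / real n \<and>
                  of_int (snd k) / real n \<le> x $ 2 \<and> x $ 2 < (of_int (snd k) + 1) / real n}"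

definition node :: "nat \<Rightarrow> int \<times> int \<Rightarrow> real^2" where
  "node n k = vector [(of_int (fst k) + 1 / 2) / real n, (of_int (snd k) + 1 / 2) / real n]"

definition step_space :: "nat \<Rightarrow> (real^2 \<Rightarrow> real) set" where
  "step_space n = {u. (\<forall>k\<in>grid n. \<forall>x\<in>cell n k \<inter> Omega. u x = u (node n k)) \<and>
                      (\<forall>x. x \<notin> Omega \<longrightarrow> u x = 0)}"

definition step_fun :: "nat \<Rightarrow> (int \<times> int \<Rightarrow> real) \<Rightarrow> real^2 \<Rightarrow> real" where
  "step_fun n c x = (\<Sum>k\<in>grid n. c k * indicator (cell n k \<inter> Omega) x)"

definition neighbours :: "nat \<Rightarrow> real \<Rightarrow> int \<times> int \<Rightarrow> (int \<times> int) set" where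
  "neighbours n w k = {l. interior (cell n l) \<inter> sq_ball w (node n k) \<noteq> {}}"

definition w_disc :: "nat \<Rightarrow> real \<Rightarrow> real" where
  "w_disc n w = (of_int \<lceil>w * real n - 1 / 2\<rceil> + 1 / 2) / real n"

definition weight :: "nat \<Rightarrow> real \<Rightarrow> real \<Rightarrow> int \<times> int \<Rightarrow> int \<times> int \<Rightarrow> real" where
  "weight n \<sigma> w k l =
     (1 / real n)\<^sup>2 / (2 * pi * alpha \<sigma> (w_disc n w)) * gauss \<sigma> (node n k - node n l)"

text \<open>
  The description is proper only if some node has its whole neighbourhood inside \<^const>\<open>Omega\<close>,
  that is, for \<open>w < 1 / 2\<close> and \<open>n\<close> large.
\<close>

definition eta :: "nat \<Rightarrow> real \<Rightarrow> real \<Rightarrow> real" where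
  "eta n \<sigma> w = (THE \<eta>. \<forall>k\<in>grid n. sq_ball (w_disc n w) (node n k) \<subseteq> Omega \<longrightarrow>
     (1 + \<eta>) * (\<Sum>l\<in>neighbours n w k. weight n \<sigma> w k l) = 1)"

definition blur_disc :: "nat \<Rightarrow> real \<Rightarrow> real \<Rightarrow> (real^2 \<Rightarrow> real) \<Rightarrow> real^2 \<Rightarrow> real" where
  "blur_disc n \<sigma> w u = step_fun n (\<lambda>k.
     (1 + eta n \<sigma> w) * (\<Sum>l\<in>neighbours n w k. weight n \<sigma> w k l * u (node n l)))"

end

theory Submission
  imports Defs
begin

text \<open>
  On a pair of cells, the kernels of \<^const>\<open>blur\<close> and \<^const>\<open>blur_disc\<close> differ by \<open>O(h)\<close>, by
  Lipschitz continuity of the Gaussian, unless one coordinate distance of the cells is within \<open>2 h\<close>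
  of \<open>w\<close>, where the cut-offs may disagree and the difference is only \<open>O(1)\<close>. From each cell there are
  only \<open>O(n)\<close> exceptional cells, of total area \<open>O(h)\<close>. Hence the matrix of
  cellwise error bounds is symmetric with row sums \<open>O(h)\<close>, and the Schur test gives the first estimate.
  The second estimate is the Cauchy-Schwarz inequality for a bounded kernel.
\<close>

subsection \<open>Cells of the grid\<close>

text \<open>The operators also differ in their normalizing constants: \<open>blur\<close> divides by
  \<open>a = 2 * pi * alpha \<sigma> w\<close>, and \<open>blur_disc\<close>, once
  \<open>eta\<close> is resolved, by the Riemann sum \<open>disc_mass\<close>. Their difference is
  O(h) without a separate quadrature argument: both are translation invariant, hence can be
  evaluated at a node near the centre of \<open>Omega\<close>, whose neighbourhood stays inside
  \<open>Omega\<close> because w < 1/2. There they are row sums of the two matrices that are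
  compared anyway, i.e. the operators applied to the constant 1. The boundary of
  \<open>Omega\<close> causes no extra error: neither operator is renormalized there, and since step
  functions vanish outside \<open>Omega\<close>, both reduce to sums over \<open>grid n\<close>. The
  O(1) discrepancy at the cut-off rules out an O(h) bound on the kernel itself; it is small only
  after summation over a row or a column, hence the Schur test.\<close>

lemma floor_of_nat_mult_eq_iff:
  assumes "n > 0"
  shows "\<lfloor>real n * t\<rfloor> = a \<longleftrightarrow> of_int a / real n \<le> t \<and> t < (of_int a + 1) / real n"
  using assms by (simp add: floor_eq_iff field_simps)

lemma cell_iff:
  assumes "n > 0"
  shows "x \<in> cell n k \<longleftrightarrow> k = (\<lfloor>real n * x $ 1\<rfloor>, \<lfloor>real n * x $ 2\<rfloor>)"
proof -
  have "x \<in> cell n k \<longleftrightarrow> \<lfloor>real n * x $ 1\<rfloor> = fst k \<and> \<lfloor>real n * x $ 2\<rfloor> = snd k"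
    unfolding floor_of_nat_mult_eq_iff[OF assms] by (simp add: cell_def)
  then show ?thesis by (auto simp: prod_eq_iff)
qed

lemma Omega_imp_grid:
  assumes "n > 0" "x \<in> Omega"
  shows "(\<lfloor>real n * x $ 1\<rfloor>, \<lfloor>real n * x $ 2\<rfloor>) \<in> grid n"
proof -
  have "real n * x $ i < real n" if "x $ i < 1" for i
    using assms(1) that by simp
  then show ?thesis
    using assms by (auto simp: grid_def Omega_def floor_less_iff)
qed

lemma finite_grid [simp]: "finite (grid n)"
  by (simp add: grid_def)

text \<open>The half-open cells are the level sets of the floor index, so exactly one term survives,
  and its index is in \<open>grid n\<close> when \<open>x\<close> is in \<open>Omega\<close>.
  Identities between step functions therefore hold at every point, with no exceptional null set on
  the edges.\<close>

lemma sum_indicator_cell: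
  assumes "n > 0"
  shows "(\<Sum>k\<in>grid n. c k * indicator (cell n k \<inter> Omega) x) =
    (c (\<lfloor>real n * x $ 1\<rfloor>, \<lfloor>real n * x $ 2\<rfloor>) * indicator Omega x :: real)"
proof (cases "x \<in> Omega")
  case True
  let ?k = "(\<lfloor>real n * x $ 1\<rfloor>, \<lfloor>real n * x $ 2\<rfloor>)"
  have "(\<Sum>k\<in>grid n. c k * indicator (cell n k \<inter> Omega) x) = (\<Sum>k\<in>grid n. if k = ?k then c k else 0)"
    using True by (intro sum.cong) (auto simp: indicator_def cell_iff[OF assms])
  also have "\<dots> = c ?k"
    using Omega_imp_grid[OF assms True] by simp
  finally show ?thesis using True by simp
qed simp

definition cell_lo :: "nat \<Rightarrow> int \<times> int \<Rightarrow> real^2" where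
  "cell_lo n k = vector [of_int (fst k) / real n, of_int (snd k) / real n]"

definition cell_hi :: "nat \<Rightarrow> int \<times> int \<Rightarrow> real^2" where
  "cell_hi n k = vector [(of_int (fst k) + 1) / real n, (of_int (snd k) + 1) / real n]"

lemma box_subset_cell: "box (cell_lo n k) (cell_hi n k) \<subseteq> cell n k"
  by (auto simp: mem_box_cart forall_2 cell_def cell_lo_def cell_hi_def)

lemma cell_subset_cbox: "cell n k \<subseteq> cbox (cell_lo n k) (cell_hi n k)"
  by (auto simp: mem_box_cart forall_2 cell_def cell_lo_def cell_hi_def)

lemma interior_cell: "interior (cell n k) = box (cell_lo n k) (cell_hi n k)"
  using interior_mono[OF cell_subset_cbox, of n k] interior_maximal[OF box_subset_cell open_box, of n k]
  by simp

lemma box_cell_subset_Omega: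
  assumes "k \<in> grid n"
  shows "box (cell_lo n k) (cell_hi n k) \<subseteq> Omega"
proof
  fix x assume x: "x \<in> box (cell_lo n k) (cell_hi n k)"
  have "n > 0" using assms by (auto simp: grid_def)
  have "0 \<le> real_of_int a / real n" "(real_of_int a + 1) / real n \<le> 1" if "a \<in> {0..<int n}" for a
    using that \<open>n > 0\<close> by (simp_all add: field_simps)
  moreover have "fst k \<in> {0..<int n}" "snd k \<in> {0..<int n}"
    using assms by (auto simp: grid_def)
  ultimately have "0 \<le> real_of_int (fst k) / real n" "(real_of_int (fst k) + 1) / real n \<le> 1"
    "0 \<le> real_of_int (snd k) / real n" "(real_of_int (snd k) + 1) / real n \<le> 1"
    by blast+
  then show "x \<in> Omega"
    using x by (simp add: mem_box_cart forall_2 cell_lo_def cell_hi_def Omega_def)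
qed

section \<open>Measurability, areas of cells, integrals and norms of step functions\<close>

lemma measurable_coord [measurable]: "(\<lambda>x::real^2. x $ i) \<in> borel_measurable borel"
  by (intro borel_measurable_continuous_onI continuous_intros)

lemma sets_Omega [measurable]: "Omega \<in> sets borel"
  unfolding Omega_def by measurable

lemma sets_cell [measurable]: "cell n k \<in> sets borel"
  unfolding cell_def by measurable

lemma sets_sq_ball [measurable]: "sq_ball r z \<in> sets borel"
  unfolding sq_ball_def infnorm_2 by measurable

lemma measurable_gauss [measurable]: "gauss \<sigma> \<in> borel_measurable borel"
  unfolding gauss_def[abs_def] by measurable

text \<open>A cell with a zero index loses an edge to the intersection with \<open>Omega\<close>, so
  the set need not be a half-open box; it is caught between an open and a closed box of equal
  volume.\<close>

lemma emeasure_cell_Omega: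
  assumes "k \<in> grid n"
  shows "emeasure lborel (cell n k \<inter> Omega) = ennreal ((1 / real n)\<^sup>2)"
proof -
  have lh: "\<forall>b\<in>Basis. cell_lo n k \<bullet> b \<le> cell_hi n k \<bullet> b"
    by (auto simp: Basis_vec_def inner_axis cell_lo_def cell_hi_def forall_2 divide_right_mono)
  have p: "(\<Prod>b\<in>Basis. (cell_hi n k - cell_lo n k) \<bullet> b) = (1 / real n)\<^sup>2"
    by (simp add: Basis_vec_def UNIV_2 axis_eq_axis inner_axis cell_lo_def cell_hi_def power2_eq_square
        flip: diff_divide_distrib)
  have "ennreal ((1 / real n)\<^sup>2) \<le> emeasure lborel (cell n k \<inter> Omega)"
    using lh p emeasure_mono[of "box (cell_lo n k) (cell_hi n k)" "cell n k \<inter> Omega" lborel]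
      box_subset_cell[of n k] box_cell_subset_Omega[OF assms]
    by (simp add: emeasure_lborel_box)
  moreover have "emeasure lborel (cell n k \<inter> Omega) \<le> ennreal ((1 / real n)\<^sup>2)"
    using lh p emeasure_mono[of "cell n k \<inter> Omega" "cbox (cell_lo n k) (cell_hi n k)" lborel]
      cell_subset_cbox[of n k]
    by (auto simp add: emeasure_lborel_cbox)
  ultimately show ?thesis by simp
qed

lemma integral_step:
  assumes "n > 0"
  shows "integrable lborel (\<lambda>x. \<Sum>k\<in>grid n. c k * indicator (cell n k \<inter> Omega) x :: real)"
    and "integral\<^sup>L lborel (\<lambda>x. \<Sum>k\<in>grid n. c k * indicator (cell n k \<inter> Omega) x) = (\<Sum>k\<in>grid n. c k * (1 / real n)\<^sup>2)"
proof -
  have i: "integrable lborel (\<lambda>x. c k * indicator (cell n k \<inter> Omega) x :: real)" if "k \<in> grid n" for k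
    using emeasure_cell_Omega[OF that] by (intro integrable_mult_right integrable_real_indicator) auto
  show "integrable lborel (\<lambda>x. \<Sum>k\<in>grid n. c k * indicator (cell n k \<inter> Omega) x :: real)"
    by (intro Bochner_Integration.integrable_sum i)
  show "integral\<^sup>L lborel (\<lambda>x. \<Sum>k\<in>grid n. c k * indicator (cell n k \<inter> Omega) x) = (\<Sum>k\<in>grid n. c k * (1 / real n)\<^sup>2)"
    by (subst Bochner_Integration.integral_sum) (auto intro!: i sum.cong simp: measure_def emeasure_cell_Omega)
qed

lemma step_space_expand:
  assumes "n > 0" "u \<in> step_space n"
  shows "u x = (\<Sum>k\<in>grid n. u (node n k) * indicator (cell n k \<inter> Omega) x)"
proof (cases "x \<in> Omega")
  case True
  then show ?thesis
    using assms Omega_imp_grid[OF assms(1) True] unfolding sum_indicator_cell[OF assms(1)] step_space_def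
    by (auto simp: cell_iff[OF assms(1)])
next
  case False
  then show ?thesis using assms by (simp add: step_space_def)
qed

lemma L2_norm_step:
  assumes "n > 0" "u \<in> step_space n"
  shows "L2_norm_Omega u = sqrt (1 / (2 * pi) * (\<Sum>k\<in>grid n. (1 / real n)\<^sup>2 * (u (node n k))\<^sup>2))"
proof -
  have *: "indicator Omega x *\<^sub>R (u x)\<^sup>2 = (\<Sum>k\<in>grid n. (u (node n k))\<^sup>2 * indicator (cell n k \<inter> Omega) x)" for x
    unfolding step_space_expand[OF assms, of x] sum_indicator_cell[OF assms(1)]
    by (simp add: indicator_def)
  show ?thesis
    unfolding L2_norm_Omega_def set_lebesgue_integral_def * integral_step[OF assms(1)]
    by (simp add: mult.commute)
qed

lemma L2_norm_le_step:
  assumes "n > 0"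
    and le: "\<And>k x. k \<in> grid n \<Longrightarrow> x \<in> cell n k \<inter> Omega \<Longrightarrow> (f x)\<^sup>2 \<le> F k"
  shows "L2_norm_Omega f \<le> sqrt (1 / (2 * pi) * (\<Sum>k\<in>grid n. (1 / real n)\<^sup>2 * F k))"
proof -
  have b: "0 \<le> indicator Omega x *\<^sub>R (f x)\<^sup>2"
    "indicator Omega x *\<^sub>R (f x)\<^sup>2 \<le> (\<Sum>k\<in>grid n. F k * indicator (cell n k \<inter> Omega) x)" for x
    using le[of "(\<lfloor>real n * x $ 1\<rfloor>, \<lfloor>real n * x $ 2\<rfloor>)" x] Omega_imp_grid[OF assms(1), of x]
    unfolding sum_indicator_cell[OF assms(1)] by (auto simp: indicator_def cell_iff[OF assms(1)])
  \<comment> \<open>\<open>integral_mono'\<close> asks for integrability of the majorant alone, the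
    Bochner integral of a non-integrable function being 0. This spares a measurability proof for
    \<open>blur\<close>.\<close>
  have "(LINT x:Omega|lborel. (f x)\<^sup>2) \<le> (\<Sum>k\<in>grid n. F k * (1 / real n)\<^sup>2)"
    unfolding set_lebesgue_integral_def integral_step(2)[OF assms(1), symmetric]
    by (intro integral_mono' integral_step(1)[OF assms(1)] b order_trans[OF b])
  then show ?thesis
    unfolding L2_norm_Omega_def by (intro real_sqrt_le_mono mult_left_mono) (auto simp: mult.commute)
qed

lemma exists_between_2:
  fixes a b c d :: real
  assumes "a < c" "a < d" "b < c" "b < d"
  shows "\<exists>t. a < t \<and> b < t \<and> t < c \<and> t < d"
  using dense[of "max a b" "min c d"] assms by auto

text \<open>Interior cell and ball are both products of open intervals, so the coordinates decouple.
  After scaling by \<open>real n\<close> the intervals have half-lengths 1/2 and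
  \<open>w * real n\<close>, and two open intervals meet iff their centres are closer than the sum
  of the half-lengths.\<close>

lemma neighbours_iff:
  assumes "n > 0" "w > 0"
  shows "l \<in> neighbours n w k \<longleftrightarrow>
    \<bar>of_int (fst k - fst l)\<bar> < w * real n + 1 / 2 \<and> \<bar>of_int (snd k - snd l)\<bar> < w * real n + 1 / 2"
proof -
  have one: "(\<exists>t. of_int b / real n < t \<and> t < (of_int b + 1) / real n \<and> \<bar>t - (of_int a + 1 / 2) / real n\<bar> < w)
      \<longleftrightarrow> \<bar>of_int (a - b)\<bar> < w * real n + 1 / 2" (is "?L \<longleftrightarrow> ?R") for a b :: int
  proof
    assume ?L
    then obtain t where "of_int b < t * real n" "t * real n < of_int b + 1"
      and t: "\<bar>t - (of_int a + 1 / 2) / real n\<bar> < w"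
      using assms by (auto simp: field_simps)
    moreover have "\<bar>t * real n - (of_int a + 1 / 2)\<bar> < w * real n"
      using t assms by (simp add: abs_less_iff field_simps)
    ultimately show ?R by (auto simp: abs_less_iff)
  next
    assume ?R
    have "w * real n > 0" using assms by simp
    with \<open>?R\<close> obtain t where t: "of_int b < t" "of_int a + 1 / 2 - w * real n < t"
      "t < of_int b + 1" "t < of_int a + 1 / 2 + w * real n"
      using exists_between_2[of "of_int b" "of_int b + 1" "of_int a + 1 / 2 + w * real n" "of_int a + 1 / 2 - w * real n"]
      by (auto simp: abs_less_iff)
    show ?L
      using t assms by (intro exI[of _ "t / real n"]) (auto simp: abs_less_iff field_simps)
  qed
  have "l \<in> neighbours n w k \<longleftrightarrow> (\<exists>x\<in>interior (cell n l). x \<in> sq_ball w (node n k))"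
    by (auto simp: neighbours_def)
  also have "\<dots> \<longleftrightarrow> (\<exists>s t. (of_int (fst l) / real n < s \<and> s < (of_int (fst l) + 1) / real n \<and> \<bar>s - (of_int (fst k) + 1 / 2) / real n\<bar> < w)
      \<and> (of_int (snd l) / real n < t \<and> t < (of_int (snd l) + 1) / real n \<and> \<bar>t - (of_int (snd k) + 1 / 2) / real n\<bar> < w))" (is "_ \<longleftrightarrow> (\<exists>s t. ?P s t)")
  proof
    assume "\<exists>x\<in>interior (cell n l). x \<in> sq_ball w (node n k)"
    then obtain x where "x \<in> interior (cell n l)" "x \<in> sq_ball w (node n k)" by blast
    then have "?P (x $ 1) (x $ 2)"
      by (simp add: interior_cell mem_box_cart forall_2 cell_lo_def cell_hi_def sq_ball_def infnorm_2 node_def)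
    then show "\<exists>s t. ?P s t" by blast
  next
    assume "\<exists>s t. ?P s t"
    then obtain s t where "?P s t" by blast
    then show "\<exists>x\<in>interior (cell n l). x \<in> sq_ball w (node n k)"
      by (intro bexI[of _ "vector [s, t]"])
         (auto simp: interior_cell mem_box_cart forall_2 cell_lo_def cell_hi_def sq_ball_def infnorm_2 node_def)
  qed
  finally show ?thesis
    unfolding one[symmetric] by blast
qed

subsection \<open>Comparison of the kernels\<close>

lemma gauss_bounds:
  assumes "\<sigma> > 0"
  shows "0 < gauss \<sigma> x" "gauss \<sigma> x \<le> 1 / \<sigma>\<^sup>2"
proof -
  show "0 < gauss \<sigma> x" using assms by (simp add: gauss_def)
  have "exp (- (norm x)\<^sup>2 / (2 * \<sigma>\<^sup>2)) \<le> 1" by simp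
  then show "gauss \<sigma> x \<le> 1 / \<sigma>\<^sup>2"
    unfolding gauss_def by (intro mult_left_le) auto
qed

lemma exp_minus_lipschitz:
  fixes s t :: real
  assumes "0 \<le> s" "0 \<le> t"
  shows "\<bar>exp (- s) - exp (- t)\<bar> \<le> \<bar>s - t\<bar>"
proof -
  have *: "exp (- a) - exp (- b) \<le> b - a" if "0 \<le> a" "a \<le> b" for a b :: real
  proof -
    have "1 + (a - b) \<le> exp (a - b)" by (rule exp_ge_add_one_self)
    then have "exp (- a) * (1 + (a - b)) \<le> exp (- a) * exp (a - b)"
      by (intro mult_left_mono) auto
    also have "exp (- a) * exp (a - b) = exp (- b)"
      by (simp add: exp_add[symmetric])
    finally have "exp (- a) - exp (- b) \<le> exp (- a) * (b - a)"
      by (simp add: algebra_simps)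
    also have "\<dots> \<le> 1 * (b - a)"
      using that by (intro mult_right_mono) auto
    finally show ?thesis by simp
  qed
  show ?thesis
    using *[of s t] *[of t s] assms by (cases "s \<le> t") (auto simp: abs_if)
qed

text \<open>The exponential is 1-Lipschitz in the squared norm over
  \<open>2 * \<sigma>\<^sup>2\<close>, and a difference of squares contributes the sum of the norms,
  at most 4. The radius 2 suffices since the arguments will be differences of points of
  \<open>Omega\<close>.\<close>

lemma gauss_lipschitz:
  assumes "\<sigma> > 0" "norm x \<le> 2" "norm y \<le> 2"
  shows "\<bar>gauss \<sigma> x - gauss \<sigma> y\<bar> \<le> 2 / \<sigma> ^ 4 * norm (x - y)"
proof -
  have "\<bar>gauss \<sigma> x - gauss \<sigma> y\<bar> =
      1 / \<sigma>\<^sup>2 * \<bar>exp (- ((norm x)\<^sup>2 / (2 * \<sigma>\<^sup>2))) - exp (- ((norm y)\<^sup>2 / (2 * \<sigma>\<^sup>2)))\<bar>"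
    by (simp add: gauss_def abs_mult flip: diff_divide_distrib)
  also have "\<dots> \<le> 1 / \<sigma>\<^sup>2 * \<bar>(norm x)\<^sup>2 / (2 * \<sigma>\<^sup>2) - (norm y)\<^sup>2 / (2 * \<sigma>\<^sup>2)\<bar>"
    by (intro mult_left_mono exp_minus_lipschitz) auto
  also have "\<bar>(norm x)\<^sup>2 / (2 * \<sigma>\<^sup>2) - (norm y)\<^sup>2 / (2 * \<sigma>\<^sup>2)\<bar> =
      (norm x + norm y) * \<bar>norm x - norm y\<bar> / (2 * \<sigma>\<^sup>2)"
  proof -
    have "(norm x)\<^sup>2 / (2 * \<sigma>\<^sup>2) - (norm y)\<^sup>2 / (2 * \<sigma>\<^sup>2) = (norm x + norm y) * (norm x - norm y) / (2 * \<sigma>\<^sup>2)"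
      by (simp add: power2_eq_square algebra_simps diff_divide_distrib)
    then show ?thesis by (simp add: abs_mult)
  qed
  also have "1 / \<sigma>\<^sup>2 * ((norm x + norm y) * \<bar>norm x - norm y\<bar> / (2 * \<sigma>\<^sup>2))
      \<le> 1 / \<sigma>\<^sup>2 * (4 * norm (x - y) / (2 * \<sigma>\<^sup>2))"
    using assms by (intro mult_left_mono divide_right_mono mult_mono norm_triangle_ineq3) auto
  also have "\<dots> = 2 / \<sigma> ^ 4 * norm (x - y)"
    by (simp add: power4_eq_xxxx power2_eq_square)
  finally show ?thesis .
qed

lemma norm_le_2: "norm (x :: real^2) \<le> \<bar>x $ 1\<bar> + \<bar>x $ 2\<bar>"
  using norm_le_l1_cart[of x] by (simp add: sum_2)

lemma norm_diff_Omega: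
  assumes "x \<in> Omega" "y \<in> Omega"
  shows "norm (x - y) \<le> 2"
  using norm_le_2[of "x - y"] assms by (auto simp: Omega_def)

lemma node_in_cell:
  assumes "n > 0"
  shows "node n k \<in> cell n k"
  using assms by (auto simp: node_def cell_def divide_right_mono divide_strict_right_mono)

lemma node_in_Omega_iff:
  assumes "n > 0"
  shows "node n k \<in> Omega \<longleftrightarrow> k \<in> grid n"
proof
  assume "node n k \<in> Omega"
  then show "k \<in> grid n"
    using Omega_imp_grid[OF assms] node_in_cell[OF assms, of k] cell_iff[OF assms] by metis
next
  assume "k \<in> grid n"
  then show "node n k \<in> Omega"
    using assms by (auto simp: grid_def Omega_def node_def field_simps)
qed

lemma cell_dist_node:
  assumes "n > 0" "x \<in> cell n k"
  shows "\<bar>real n * x $ 1 - (of_int (fst k) + 1 / 2)\<bar> \<le> 1 / 2"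
    and "\<bar>real n * x $ 2 - (of_int (snd k) + 1 / 2)\<bar> \<le> 1 / 2"
  using assms by (auto simp: cell_def field_simps abs_le_iff)

text \<open>Distances are counted in cells. The disjunction describes full strips across the grid, a
  superset of a square ring that is easier to count and still has only O(n) cells. The margin 2
  absorbs the discrepancy, at most 1, between coordinate differences of points and of indices, and
  the shift 1/2 of the neighbour threshold.\<close>

definition annulus :: "nat \<Rightarrow> real \<Rightarrow> int \<times> int \<Rightarrow> int \<times> int \<Rightarrow> bool" where
  "annulus n w k l \<longleftrightarrow> \<bar>of_int (fst k - fst l)\<bar> \<in> {w * real n - 2..w * real n + 2} \<or> \<bar>of_int (snd k - snd l)\<bar> \<in> {w * real n - 2..w * real n + 2}"

text \<open>The first constant is the Lipschitz constant \<open>2 / \<sigma> ^ 4\<close> times a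
  displacement of at most 2 h; the second is the maximum of the Gaussian.\<close>

definition kernel_err :: "nat \<Rightarrow> real \<Rightarrow> real \<Rightarrow> int \<times> int \<Rightarrow> int \<times> int \<Rightarrow> real" where
  "kernel_err n \<sigma> w k l = 4 / \<sigma> ^ 4 * (1 / real n) + 1 / \<sigma>\<^sup>2 * of_bool (annulus n w k l)"

text \<open>The weight without area and normalization. Turning the neighbourhood into a 0/1 factor
  lets all sums run over \<open>grid n\<close>, whatever \<open>k\<close> is.\<close>

definition disc_kernel :: "nat \<Rightarrow> real \<Rightarrow> real \<Rightarrow> int \<times> int \<Rightarrow> int \<times> int \<Rightarrow> real" where
  "disc_kernel n \<sigma> w k l = of_bool (l \<in> neighbours n w k) * gauss \<sigma> (node n k - node n l)"

lemma kernel_err_nonneg: "\<sigma> > 0 \<Longrightarrow> 0 \<le> kernel_err n \<sigma> w k l"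
  by (simp add: kernel_err_def)

lemma kernel_err_commute: "kernel_err n \<sigma> w k l = kernel_err n \<sigma> w l k"
  unfolding kernel_err_def annulus_def of_int_diff by (simp only: abs_minus_commute)

lemma disc_kernel_bounds:
  assumes "\<sigma> > 0"
  shows "0 \<le> disc_kernel n \<sigma> w k l" "disc_kernel n \<sigma> w k l \<le> 1 / \<sigma>\<^sup>2"
  using gauss_bounds[OF assms, of "node n k - node n l"] by (auto simp: disc_kernel_def)

text \<open>Here \<open>a\<close>, \<open>b\<close> stand for point coordinates in units of the cell
  size and \<open>s\<close>, \<open>t\<close> for cell indices. The distances of the points and of
  the indices differ by at most 1, so away from the margin both lie below their thresholds or both
  above.\<close>

lemma abs_diff_less_iff_centres:
  fixes a b s t r :: real
  assumes "\<bar>a - (s + 1 / 2)\<bar> \<le> 1 / 2" "\<bar>b - (t + 1 / 2)\<bar> \<le> 1 / 2" "\<bar>s - t\<bar> \<notin> {r - 2..r + 2}"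
  shows "\<bar>b - a\<bar> < r \<longleftrightarrow> \<bar>s - t\<bar> < r + 1 / 2"
proof -
  have "p < r \<longleftrightarrow> q < r + 1 / 2" if "p \<le> q + 1" "q \<le> p + 1" "q \<notin> {r - 2..r + 2}" for p q :: real
    using that unfolding atLeastAtMost_iff by linarith
  moreover have "\<bar>b - a\<bar> \<le> \<bar>s - t\<bar> + 1" "\<bar>s - t\<bar> \<le> \<bar>b - a\<bar> + 1"
    using assms(1,2) by (simp_all only: abs_le_iff) linarith+
  ultimately show ?thesis
    using assms(3) by blast
qed

lemma sq_ball_iff_neighbours:
  assumes n: "n > 0" and w: "w > 0" and "\<not> annulus n w k l" and x: "x \<in> cell n k" and y: "y \<in> cell n l"
  shows "y \<in> sq_ball w x \<longleftrightarrow> l \<in> neighbours n w k"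
proof -
  have lt: "\<bar>t\<bar> < w \<longleftrightarrow> \<bar>real n * t\<bar> < w * real n" for t
    using n by (simp add: abs_mult mult.commute)
  have "\<bar>of_int (fst k) - of_int (fst l)\<bar> \<notin> {w * real n - 2..w * real n + 2}"
    "\<bar>of_int (snd k) - of_int (snd l)\<bar> \<notin> {w * real n - 2..w * real n + 2}"
    using assms(3) unfolding annulus_def of_int_diff by blast+
  note iff = abs_diff_less_iff_centres[OF cell_dist_node(1)[OF n x] cell_dist_node(1)[OF n y] this(1)]
    abs_diff_less_iff_centres[OF cell_dist_node(2)[OF n x] cell_dist_node(2)[OF n y] this(2)]
  have "y \<in> sq_ball w x \<longleftrightarrow> \<bar>real n * y $ 1 - real n * x $ 1\<bar> < w * real n \<and> \<bar>real n * y $ 2 - real n * x $ 2\<bar> < w * real n"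
    unfolding sq_ball_def infnorm_2 using lt[of "y $ 1 - x $ 1"] lt[of "y $ 2 - x $ 2"]
    by (simp add: right_diff_distrib)
  then show ?thesis
    unfolding iff neighbours_iff[OF n w] of_int_diff .
qed

lemma kernel_compare:
  assumes n: "n > 0" and w: "w > 0" and s: "\<sigma> > 0" and k: "k \<in> grid n" and l: "l \<in> grid n"
    and x: "x \<in> cell n k \<inter> Omega" and y: "y \<in> cell n l \<inter> Omega"
  shows "\<bar>indicator (sq_ball w x) y * gauss \<sigma> (x - y) - disc_kernel n \<sigma> w k l\<bar> \<le> kernel_err n \<sigma> w k l"
proof (cases "annulus n w k l")
  case True
  \<comment> \<open>Both terms lie between 0 and the maximum of the Gaussian, hence so does the
    modulus of their difference.\<close>
  have "\<bar>indicator (sq_ball w x) y * gauss \<sigma> (x - y) - disc_kernel n \<sigma> w k l\<bar> \<le> 1 / \<sigma>\<^sup>2"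
    using disc_kernel_bounds[OF s, of n w k l] gauss_bounds[OF s, of "x - y"]
    by (auto simp: indicator_def)
  then show ?thesis
    using True s by (simp add: kernel_err_def add_increasing)
next
  case False
  let ?d = "(x - y) - (node n k - node n l)"
  have dist: "\<bar>z $ 1 - node n j $ 1\<bar> \<le> 1 / 2 / real n" "\<bar>z $ 2 - node n j $ 2\<bar> \<le> 1 / 2 / real n"
    if "z \<in> cell n j" for z j
    using cell_dist_node[OF n that] n by (auto simp: node_def field_simps abs_le_iff)
  \<comment> \<open>Each of the two points is within h/2 of its node in either coordinate, and the
    two errors add up.\<close>
  have "\<bar>?d $ 1\<bar> \<le> 1 / real n" "\<bar>?d $ 2\<bar> \<le> 1 / real n"
    using dist[OF IntD1[OF x]] dist[OF IntD1[OF y]] unfolding vector_minus_component abs_le_iff by linarith+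
  then have "norm ?d \<le> 2 * (1 / real n)"
    using norm_le_2[of ?d] by linarith
  then have "2 / \<sigma> ^ 4 * norm ?d \<le> 2 / \<sigma> ^ 4 * (2 * (1 / real n))"
    using s by (intro mult_left_mono) auto
  moreover have "\<bar>gauss \<sigma> (x - y) - gauss \<sigma> (node n k - node n l)\<bar> \<le> 2 / \<sigma> ^ 4 * norm ?d"
    using x y k l by (intro gauss_lipschitz s norm_diff_Omega) (auto simp: node_in_Omega_iff n)
  ultimately have "\<bar>gauss \<sigma> (x - y) - gauss \<sigma> (node n k - node n l)\<bar> \<le> kernel_err n \<sigma> w k l"
    using False by (simp add: kernel_err_def)
  then show ?thesis
    using sq_ball_iff_neighbours[OF n w False, of x y] x y kernel_err_nonneg[OF s, of n w k l]
    by (auto simp: indicator_def disc_kernel_def)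
qed

section \<open>Counting exceptional cells, row sums of the error\<close>

lemma card_int_annulus:
  fixes r :: real and j :: int
  shows "card {a. \<bar>of_int (j - a)\<bar> \<in> {r - 2..r + 2}} \<le> 10" "finite {a. \<bar>of_int (j - a)\<bar> \<in> {r - 2..r + 2}}"
proof -
  \<comment> \<open>The integers within 2 of \<open>t\<close>, at most 5 of them. The condition on
    \<open>a\<close> says that it is this close to \<open>j - r\<close> or to \<open>j + r\<close>,
    whence the bound 10.\<close>
  define I where "I t = {\<lceil>t\<rceil> - 2..\<lfloor>t\<rfloor> + 2}" for t :: real
  have c: "card (I t) \<le> 5" for t
    using floor_le_ceiling[of t] by (simp add: I_def nat_le_iff)
  have "{a. \<bar>of_int (j - a)\<bar> \<in> {r - 2..r + 2}} \<subseteq> I (of_int j - r) \<union> I (of_int j + r)"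
  proof
    fix a assume a: "a \<in> {a. \<bar>of_int (j - a)\<bar> \<in> {r - 2..r + 2}}"
    have I: "a \<in> I t" if "\<bar>of_int a - t\<bar> \<le> 2" for t
      using that unfolding I_def abs_le_iff atLeastAtMost_iff by linarith
    have "\<bar>of_int a - (of_int j - r)\<bar> \<le> 2 \<or> \<bar>of_int a - (of_int j + r)\<bar> \<le> 2"
      using a by (cases "a \<le> j") (simp_all add: abs_le_iff)
    then show "a \<in> I (of_int j - r) \<union> I (of_int j + r)"
      using I by blast
  qed
  moreover have "finite (I t)" for t by (simp add: I_def)
  moreover have "card (I (of_int j - r) \<union> I (of_int j + r)) \<le> 10"
    using card_Un_le[of "I (of_int j - r)" "I (of_int j + r)"] c[of "of_int j - r"] c[of "of_int j + r"] by linarith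
  ultimately show "card {a. \<bar>of_int (j - a)\<bar> \<in> {r - 2..r + 2}} \<le> 10" "finite {a. \<bar>of_int (j - a)\<bar> \<in> {r - 2..r + 2}}"
    by (meson card_mono finite_UnI le_trans finite_subset)+
qed

text \<open>At most 10 columns and 10 rows are exceptional, each with \<open>n\<close> cells in the
  grid.\<close>

lemma card_annulus: "card {l \<in> grid n. annulus n w k l} \<le> 20 * n"
proof -
  define A where "A j = {a. \<bar>of_int (j - a)\<bar> \<in> {w * real n - 2..w * real n + 2}}" for j :: int
  have A: "card (A j) \<le> 10" "finite (A j)" for j
    unfolding A_def by (rule card_int_annulus)+
  have "card {l \<in> grid n. annulus n w k l} \<le> card (A (fst k) \<times> {0..<int n} \<union> {0..<int n} \<times> A (snd k))"
  proof (intro card_mono finite_UnI finite_cartesian_product A)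
    show "{l \<in> grid n. annulus n w k l} \<subseteq> A (fst k) \<times> {0..<int n} \<union> {0..<int n} \<times> A (snd k)"
      unfolding annulus_def grid_def A_def subset_iff Un_iff mem_Times_iff mem_Collect_eq by blast
  qed simp_all
  also have "\<dots> \<le> card (A (fst k) \<times> {0..<int n}) + card ({0..<int n} \<times> A (snd k))"
    by (rule card_Un_le)
  also have "\<dots> = card (A (fst k)) * n + n * card (A (snd k))"
    by (simp add: card_cartesian_product)
  also have "\<dots> \<le> 10 * n + n * 10"
    by (intro add_mono mult_le_mono A) auto
  finally show ?thesis by simp
qed

lemma card_grid: "card (grid n) = n\<^sup>2"
  by (simp add: grid_def card_cartesian_product power2_eq_square)

text \<open>The Lipschitz part is spread over n^2 cells of area h^2, the cut-off part over at most
  20 n of them; both totals are O(h).\<close>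

lemma sum_kernel_err:
  assumes n: "n > 0" and s: "\<sigma> > 0"
  shows "(\<Sum>l\<in>grid n. (1 / real n)\<^sup>2 * kernel_err n \<sigma> w k l) \<le> (4 / \<sigma> ^ 4 + 20 / \<sigma>\<^sup>2) * (1 / real n)"
proof -
  have "(\<Sum>l\<in>grid n. (1 / real n)\<^sup>2 * kernel_err n \<sigma> w k l) =
      (1 / real n)\<^sup>2 * (real (card (grid n)) * (4 / \<sigma> ^ 4 * (1 / real n)) + 1 / \<sigma>\<^sup>2 * real (card {l \<in> grid n. annulus n w k l}))"
    by (simp add: kernel_err_def sum.distrib Int_def conj_commute sum_of_bool_eq
        flip: sum_distrib_left sum_divide_distrib)
  also have "\<dots> \<le> (1 / real n)\<^sup>2 * (real (card (grid n)) * (4 / \<sigma> ^ 4 * (1 / real n)) + 1 / \<sigma>\<^sup>2 * real (20 * n))"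
    using card_annulus[of n w k] s by (intro mult_left_mono add_left_mono) (auto simp del: of_nat_mult)
  also have "\<dots> = (4 / \<sigma> ^ 4 + 20 / \<sigma>\<^sup>2) * (1 / real n)"
    using n by (simp add: card_grid field_simps power2_eq_square)
  finally show ?thesis .
qed

text \<open>The matrix entry of \<open>blur\<close> on step functions, before division by
  \<open>2 * pi * alpha \<sigma> w\<close>; its row index is still a point \<open>x\<close> instead
  of a cell.\<close>

definition cell_mass :: "nat \<Rightarrow> real \<Rightarrow> real \<Rightarrow> real^2 \<Rightarrow> int \<times> int \<Rightarrow> real" where
  "cell_mass n \<sigma> w x l = (LINT y:cell n l \<inter> Omega|lborel. indicator (sq_ball w x) y * gauss \<sigma> (x - y))"

lemma integrable_cell_mass:
  assumes "\<sigma> > 0" "l \<in> grid n"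
  shows "set_integrable lborel (cell n l \<inter> Omega) (\<lambda>y. indicator (sq_ball w x) y * gauss \<sigma> (x - y))"
proof -
  have *: "integrable lborel (\<lambda>y. 1 / \<sigma>\<^sup>2 * indicator (cell n l \<inter> Omega) y :: real)"
    using emeasure_cell_Omega[OF assms(2)] by (intro integrable_mult_right integrable_real_indicator) auto
  show ?thesis
    unfolding set_integrable_def
    by (rule Bochner_Integration.integrable_bound[OF *], measurable)
      (use gauss_bounds[OF assms(1)] in \<open>auto simp: indicator_def abs_of_pos intro!: AE_I2\<close>)
qed

lemma cell_mass_approx:
  assumes n: "n > 0" and w: "w > 0" and s: "\<sigma> > 0" and k: "k \<in> grid n" and l: "l \<in> grid n"
    and x: "x \<in> cell n k \<inter> Omega"
  shows "\<bar>cell_mass n \<sigma> w x l - (1 / real n)\<^sup>2 * disc_kernel n \<sigma> w k l\<bar> \<le> (1 / real n)\<^sup>2 * kernel_err n \<sigma> w k l"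
proof -
  let ?c = "cell n l \<inter> Omega" and ?f = "\<lambda>y. indicator (sq_ball w x) y * gauss \<sigma> (x - y)"
  have const: "set_integrable lborel ?c (\<lambda>_. r)" "(LINT y:?c|lborel. r) = (1 / real n)\<^sup>2 * r" for r :: real
    using emeasure_cell_Omega[OF l] by (auto simp: set_integrable_def set_lebesgue_integral_def measure_def)
  note f = integrable_cell_mass[OF s l, of w x]
  note c = kernel_compare[OF n w s k l x]
  have "(LINT y:?c|lborel. disc_kernel n \<sigma> w k l - kernel_err n \<sigma> w k l) \<le> (LINT y:?c|lborel. ?f y)"
    using c by (intro set_integral_mono const f) (force simp: abs_le_iff)
  moreover have "(LINT y:?c|lborel. ?f y) \<le> (LINT y:?c|lborel. disc_kernel n \<sigma> w k l + kernel_err n \<sigma> w k l)"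
    using c by (intro set_integral_mono const f) (force simp: abs_le_iff)
  ultimately show ?thesis
    unfolding const(2) cell_mass_def by (simp add: abs_le_iff algebra_simps)
qed

lemma integral_step_kernel:
  assumes "\<sigma> > 0"
  shows "integral\<^sup>L lborel (\<lambda>y. \<Sum>l\<in>grid n. c l * indicator (cell n l \<inter> Omega) y * (indicator (sq_ball w x) y * gauss \<sigma> (x - y)))
    = (\<Sum>l\<in>grid n. c l * cell_mass n \<sigma> w x l)"
  using integrable_cell_mass[OF assms]
  by (subst Bochner_Integration.integral_sum)
     (auto simp: set_integrable_def cell_mass_def set_lebesgue_integral_def mult.assoc)

lemma blur_step:
  assumes n: "n > 0" and s: "\<sigma> > 0" and u: "u \<in> step_space n"
  shows "blur \<sigma> w u x = (\<Sum>l\<in>grid n. u (node n l) * cell_mass n \<sigma> w x l) / (2 * pi * alpha \<sigma> w)"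
proof -
  have *: "indicator (sq_ball w x) y *\<^sub>R (gauss \<sigma> (x - y) * u y) =
      (\<Sum>l\<in>grid n. u (node n l) * indicator (cell n l \<inter> Omega) y * (indicator (sq_ball w x) y * gauss \<sigma> (x - y)))" for y
    unfolding step_space_expand[OF n u, of y] real_scaleR_def sum_distrib_left
    by (intro sum.cong refl) (simp only: mult_ac)
  have "(LINT y:sq_ball w x|lborel. gauss \<sigma> (x - y) * u y) = (\<Sum>l\<in>grid n. u (node n l) * cell_mass n \<sigma> w x l)"
    unfolding set_lebesgue_integral_def * by (rule integral_step_kernel[OF s])
  then show ?thesis
    by (simp add: blur_def field_simps)
qed

section \<open>The normalizing constant of the blur\<close>

lemma alpha_translate: "2 * pi * alpha \<sigma> w = (LINT y|lborel. indicator (sq_ball w x) y * gauss \<sigma> (x - y))"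
proof -
  have "(LINT y|lborel. indicator (sq_ball w x) y * gauss \<sigma> (x - y)) =
      (LINT y|distr lborel borel ((+) x). indicator (sq_ball w x) y * gauss \<sigma> (x - y))"
    by (simp add: lborel_distr_plus)
  \<comment> \<open>Translation invariance of the measure; the evenness of the Gaussian then removes
    the remaining sign.\<close>
  also have "\<dots> = (LINT y|lborel. indicator (sq_ball w x) (x + y) * gauss \<sigma> (x - (x + y)))"
    by (rule integral_distr) measurable
  also have "\<dots> = (LINT y:sq_ball w 0|lborel. gauss \<sigma> y)"
    by (auto simp: set_lebesgue_integral_def indicator_def sq_ball_def gauss_def intro!: Bochner_Integration.integral_cong)
  finally show ?thesis
    by (simp add: alpha_def)
qed

text \<open>A positive integrand with zero integral over the ball would make the ball a null set,
  but it is a nonempty open box.\<close>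

lemma alpha_pos:
  assumes "\<sigma> > 0" "w > 0"
  shows "alpha \<sigma> w > 0"
proof -
  let ?B = "box (vector [-w, -w] :: real^2) (vector [w, w])"
  have B: "sq_ball w 0 = ?B"
    by (auto simp: sq_ball_def infnorm_2 mem_box_cart forall_2)
  have ne: "?B \<noteq> {}"
    using assms by (auto simp: interval_ne_empty_cart forall_2)
  have int: "integrable lborel (\<lambda>x. indicator ?B x *\<^sub>R gauss \<sigma> x)"
  proof (rule Bochner_Integration.integrable_bound)
    show "integrable lborel (\<lambda>x. 1 / \<sigma>\<^sup>2 * indicator ?B x :: real)"
      by (intro integrable_mult_right integrable_real_indicator) (use emeasure_bounded_finite[OF bounded_box] in auto)
  qed (use gauss_bounds[OF assms(1)] in \<open>auto simp: indicator_def abs_of_pos intro!: AE_I2\<close>)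
  have "integral\<^sup>L lborel (\<lambda>x. indicator ?B x *\<^sub>R gauss \<sigma> x) \<noteq> 0"
  proof
    assume "integral\<^sup>L lborel (\<lambda>x. indicator ?B x *\<^sub>R gauss \<sigma> x) = 0"
    then have "AE x in lborel. indicator ?B x *\<^sub>R gauss \<sigma> x = 0"
      using integral_nonneg_eq_0_iff_AE[OF int] gauss_bounds(1)[OF assms(1), THEN less_imp_le] by auto
    then have "AE x in lborel. x \<notin> ?B"
      by eventually_elim (use gauss_bounds(1)[OF assms(1)] in \<open>auto simp: indicator_def less_imp_neq[symmetric]\<close>)
    then have "?B \<in> null_sets lborel"
      by (simp add: AE_iff_null_sets[of ?B])
    then show False
      using open_not_negligible[OF open_box ne] null_sets_completionI[of ?B lborel]
      by (auto simp: negligible_iff_null_sets)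
  qed
  moreover have "0 \<le> integral\<^sup>L lborel (\<lambda>x. indicator ?B x *\<^sub>R gauss \<sigma> x)"
    using gauss_bounds(1)[OF assms(1), THEN less_imp_le] by (intro integral_nonneg_AE) auto
  ultimately show ?thesis
    by (simp add: alpha_def set_lebesgue_integral_def B)
qed

text \<open>The kernel centred at \<open>x\<close> loses no mass when the cells are cut off at
  \<open>Omega\<close>: this is the row sum of the blur matrix away from the boundary.\<close>

lemma alpha_eq_sum_cell_mass:
  assumes n: "n > 0" and s: "\<sigma> > 0" and "sq_ball w x \<subseteq> Omega"
  shows "2 * pi * alpha \<sigma> w = (\<Sum>l\<in>grid n. cell_mass n \<sigma> w x l)"
proof -
  have "(\<Sum>l\<in>grid n. 1 * indicator (cell n l \<inter> Omega) y * (indicator (sq_ball w x) y * gauss \<sigma> (x - y))) =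
    indicator (sq_ball w x) y * gauss \<sigma> (x - y)" for y
    unfolding sum_distrib_right[symmetric] sum_indicator_cell[OF n, of "\<lambda>_. 1" y]
    using assms(3) by (auto simp: indicator_def)
  then show ?thesis
    using integral_step_kernel[OF s, where c = "\<lambda>_. 1" and n = n and w = w and x = x]
    unfolding alpha_translate[of _ _ x] by (simp only: mult_1)
qed

subsection \<open>The operators on step functions\<close>

text \<open>Writing \<open>K\<close> as the square of its root, Cauchy-Schwarz pulls one row sum out
  of each squared entry; after exchanging the sums, the column bound handles what is left.\<close>

lemma schur_test:
  fixes K :: "'a \<Rightarrow> 'a \<Rightarrow> real"
  assumes K: "\<And>k l. k \<in> A \<Longrightarrow> l \<in> A \<Longrightarrow> 0 \<le> K k l"
    and row: "\<And>k. k \<in> A \<Longrightarrow> (\<Sum>l\<in>A. K k l) \<le> R"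
    and col: "\<And>l. l \<in> A \<Longrightarrow> (\<Sum>k\<in>A. K k l) \<le> R"
    and R: "0 \<le> R"
  shows "(\<Sum>k\<in>A. (\<Sum>l\<in>A. K k l * v l)\<^sup>2) \<le> R\<^sup>2 * (\<Sum>l\<in>A. (v l)\<^sup>2)"
proof -
  have "(\<Sum>l\<in>A. K k l * v l)\<^sup>2 \<le> R * (\<Sum>l\<in>A. K k l * (v l)\<^sup>2)" if k: "k \<in> A" for k
  proof -
    have "(\<Sum>l\<in>A. K k l * v l)\<^sup>2 = (\<Sum>l\<in>A. sqrt (K k l) * (sqrt (K k l) * v l))\<^sup>2"
      using K[OF k] by (intro arg_cong[where f = "\<lambda>x. x\<^sup>2"] sum.cong) (simp_all flip: mult.assoc)
    also have "\<dots> \<le> (\<Sum>l\<in>A. (sqrt (K k l))\<^sup>2) * (\<Sum>l\<in>A. (sqrt (K k l) * v l)\<^sup>2)"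
      by (rule Cauchy_Schwarz_ineq_sum)
    also have "\<dots> = (\<Sum>l\<in>A. K k l) * (\<Sum>l\<in>A. K k l * (v l)\<^sup>2)"
      using K[OF k] by (simp add: power_mult_distrib)
    also have "\<dots> \<le> R * (\<Sum>l\<in>A. K k l * (v l)\<^sup>2)"
      using K[OF k] row[OF k] by (intro mult_right_mono sum_nonneg) auto
    finally show ?thesis .
  qed
  then have "(\<Sum>k\<in>A. (\<Sum>l\<in>A. K k l * v l)\<^sup>2) \<le> (\<Sum>k\<in>A. R * (\<Sum>l\<in>A. K k l * (v l)\<^sup>2))"
    by (rule sum_mono)
  also have "\<dots> = R * (\<Sum>l\<in>A. (\<Sum>k\<in>A. K k l) * (v l)\<^sup>2)"
    unfolding sum_distrib_left[symmetric] sum_distrib_right by (subst sum.swap) (rule refl)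
  also have "\<dots> \<le> R * (\<Sum>l\<in>A. R * (v l)\<^sup>2)"
    using R col by (intro mult_left_mono sum_mono mult_right_mono) auto
  finally show ?thesis
    by (simp add: power2_eq_square sum_distrib_left mult.assoc)
qed

text \<open>The Riemann sum for \<open>2 * pi * alpha \<sigma> w\<close>. It ranges over the whole
  neighbourhood in the extended grid, including cells outside \<open>Omega\<close>, which makes it
  independent of \<open>k\<close>.\<close>

definition disc_mass :: "nat \<Rightarrow> real \<Rightarrow> real \<Rightarrow> int \<times> int \<Rightarrow> real" where
  "disc_mass n \<sigma> w k = (\<Sum>l\<in>neighbours n w k. (1 / real n)\<^sup>2 * gauss \<sigma> (node n k - node n l))"

lemma node_diff:
  "node n k - node n l = vector [of_int (fst k - fst l) / real n, of_int (snd k - snd l) / real n]"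
  by (simp add: vec_eq_iff forall_2 node_def diff_divide_distrib add_divide_distrib)

lemma disc_mass_translate:
  assumes "n > 0" "w > 0"
  shows "disc_mass n \<sigma> w k = disc_mass n \<sigma> w k'"
  unfolding disc_mass_def
  by (rule sum.reindex_bij_witness[of _ "\<lambda>l. l + (k - k')" "\<lambda>l. l + (k' - k)"])
     (auto simp: neighbours_iff[OF assms] node_diff)

lemma finite_neighbours:
  assumes "n > 0" "w > 0"
  shows "finite (neighbours n w k)"
proof -
  have *: "a \<in> {b - \<lceil>w * real n + 1 / 2\<rceil>..b + \<lceil>w * real n + 1 / 2\<rceil>}"
    if "\<bar>of_int (b - a)\<bar> < w * real n + 1 / 2" for a b
    using that by (auto simp: abs_less_iff) linarith+
  have "neighbours n w k \<subseteq> {fst k - \<lceil>w * real n + 1 / 2\<rceil>..fst k + \<lceil>w * real n + 1 / 2\<rceil>}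
      \<times> {snd k - \<lceil>w * real n + 1 / 2\<rceil>..snd k + \<lceil>w * real n + 1 / 2\<rceil>}"
    using *[of "fst k"] *[of "snd k"] by (auto simp only: neighbours_iff[OF assms] mem_Times_iff subset_iff)
  then show ?thesis
    by (rule finite_subset) auto
qed

text \<open>Serves two situations: \<open>c\<close> given by a step function, which vanishes off the
  grid, and a constant \<open>c\<close> with a neighbourhood contained in the grid.\<close>

lemma sum_neighbours_grid:
  assumes "n > 0" "w > 0" "\<And>l. l \<in> neighbours n w k - grid n \<Longrightarrow> c l = 0"
  shows "(\<Sum>l\<in>neighbours n w k. gauss \<sigma> (node n k - node n l) * c l) = (\<Sum>l\<in>grid n. disc_kernel n \<sigma> w k l * c l)"
proof -
  have "(\<Sum>l\<in>neighbours n w k. gauss \<sigma> (node n k - node n l) * c l)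
      = (\<Sum>l\<in>grid n \<inter> neighbours n w k. gauss \<sigma> (node n k - node n l) * c l)"
    using assms(3) by (intro sum.mono_neutral_right finite_neighbours[OF assms(1,2)]) auto
  also have "\<dots> = (\<Sum>l\<in>grid n. disc_kernel n \<sigma> w k l * c l)"
    by (simp add: sum.inter_restrict disc_kernel_def) (intro sum.cong, auto)
  finally show ?thesis .
qed

section \<open>A central node and the normalization of the discrete operator\<close>

context
  fixes n :: nat and w :: real and k0 :: "int \<times> int"
  assumes w: "w > 0" and n: "2 \<le> (1 / 2 - w) * real n"
    and k0: "k0 = (int (n div 2), int (n div 2))"
begin

lemma n_pos: "n > 0"
  using n by (cases n) auto

lemma half_bounds: "real n / 2 - 1 / 2 \<le> real (n div 2)" "real (n div 2) \<le> real n / 2"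
  by linarith+

lemma centre_in_grid: "k0 \<in> grid n"
  using n_pos by (auto simp: grid_def k0)

lemma neighbours_centre: "neighbours n w k0 \<subseteq> grid n"
proof
  fix l assume "l \<in> neighbours n w k0"
  then have "\<bar>of_int (int (n div 2) - fst l)\<bar> < w * real n + 1 / 2" "\<bar>of_int (int (n div 2) - snd l)\<bar> < w * real n + 1 / 2"
    by (simp_all add: neighbours_iff[OF n_pos w] k0)
  moreover have "a \<in> {0..<int n}" if "\<bar>of_int (int (n div 2) - a)\<bar> < w * real n + 1 / 2" for a
  proof -
    have "- 1 < real_of_int a" "real_of_int a < real n"
      using that n half_bounds unfolding abs_less_iff left_diff_distrib of_int_diff of_int_of_nat_eq by linarith+
    then show ?thesis by auto
  qed
  ultimately show "l \<in> grid n"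
    unfolding grid_def mem_Times_iff by blast
qed

lemma w_disc_bounds: "w \<le> w_disc n w" "w_disc n w < w + 1 / real n"
proof -
  have "w * real n \<le> of_int \<lceil>w * real n - 1 / 2\<rceil> + 1 / 2" "of_int \<lceil>w * real n - 1 / 2\<rceil> + 1 / 2 < w * real n + 1"
    by linarith+
  then show "w \<le> w_disc n w" "w_disc n w < w + 1 / real n"
    using n_pos by (simp_all add: w_disc_def pos_le_divide_eq pos_divide_less_eq distrib_right)
qed

text \<open>In units of cells, the node is off the centre of \<open>Omega\<close> by at most 1/2 and
  the discrete radius exceeds \<open>w * real n\<close> by less than 1. The two spare cells demanded
  of \<open>n\<close> cover both.\<close>

lemma sq_ball_w_disc_centre: "sq_ball (w_disc n w) (node n k0) \<subseteq> Omega"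
proof
  fix y assume "y \<in> sq_ball (w_disc n w) (node n k0)"
  then have y: "\<bar>y $ 1 - (real (n div 2) + 1 / 2) / real n\<bar> < w + 1 / real n"
    "\<bar>y $ 2 - (real (n div 2) + 1 / 2) / real n\<bar> < w + 1 / real n"
    using w_disc_bounds(2) by (auto simp: sq_ball_def infnorm_2 node_def k0)
  have unit: "0 < t \<and> t < 1" if "\<bar>t - (real (n div 2) + 1 / 2) / real n\<bar> < w + 1 / real n" for t
  proof -
    have "t * real n - (real (n div 2) + 1 / 2) = (t - (real (n div 2) + 1 / 2) / real n) * real n"
      using n_pos by (simp add: left_diff_distrib)
    then have "\<bar>t * real n - (real (n div 2) + 1 / 2)\<bar> = \<bar>t - (real (n div 2) + 1 / 2) / real n\<bar> * real n"
      by (simp only: abs_mult abs_of_nat)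
    also have "\<dots> < (w + 1 / real n) * real n"
      using n_pos that by (intro mult_strict_right_mono) auto
    also have "\<dots> = w * real n + 1"
      using n_pos by (simp add: field_simps)
    finally have "0 < t * real n" "t * real n < real n"
      using half_bounds n by (simp_all only: abs_less_iff left_diff_distrib) linarith+
    then show ?thesis
      using n_pos by (simp add: zero_less_mult_iff)
  qed
  show "y \<in> Omega"
    using unit[OF y(1)] unit[OF y(2)] by (simp add: Omega_def)
qed

lemma sq_ball_centre: "sq_ball w (node n k0) \<subseteq> Omega"
  using sq_ball_w_disc_centre w_disc_bounds(1) by (auto simp: sq_ball_def)

text \<open>Moved to the central node, both quantities become sums over \<open>grid n\<close> of
  matrix entries, so their difference is bounded by a row sum of the kernel error.\<close>

lemma disc_mass_approx:
  assumes s: "\<sigma> > 0"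
  shows "\<bar>disc_mass n \<sigma> w k - 2 * pi * alpha \<sigma> w\<bar> \<le> (4 / \<sigma> ^ 4 + 20 / \<sigma>\<^sup>2) * (1 / real n)"
proof -
  have "disc_mass n \<sigma> w k = disc_mass n \<sigma> w k0"
    by (rule disc_mass_translate[OF n_pos w])
  also have "\<dots> = (\<Sum>l\<in>grid n. (1 / real n)\<^sup>2 * disc_kernel n \<sigma> w k0 l)"
    using sum_neighbours_grid[OF n_pos w, of k0 "\<lambda>_. (1 / real n)\<^sup>2"] neighbours_centre
    unfolding disc_mass_def by (simp only: mult.commute) blast
  finally have "\<bar>disc_mass n \<sigma> w k - 2 * pi * alpha \<sigma> w\<bar> =
      \<bar>\<Sum>l\<in>grid n. cell_mass n \<sigma> w (node n k0) l - (1 / real n)\<^sup>2 * disc_kernel n \<sigma> w k0 l\<bar>"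
    by (simp add: alpha_eq_sum_cell_mass[OF n_pos s sq_ball_centre] sum_subtractf abs_minus_commute)
  also have "\<dots> \<le> (\<Sum>l\<in>grid n. (1 / real n)\<^sup>2 * kernel_err n \<sigma> w k0 l)"
    using centre_in_grid
    by (intro order_trans[OF sum_abs] sum_mono cell_mass_approx[OF n_pos w s])
       (auto simp: node_in_cell[OF n_pos] node_in_Omega_iff[OF n_pos])
  also have "\<dots> \<le> (4 / \<sigma> ^ 4 + 20 / \<sigma>\<^sup>2) * (1 / real n)"
    by (rule sum_kernel_err[OF n_pos s])
  finally show ?thesis .
qed

text \<open>The normalization \<^term>\<open>1 + eta n \<sigma> w\<close> cancels the factor \<^term>\<open>alpha \<sigma> (w_disc n w)\<close> of the weights,
  so no comparison of \<^term>\<open>alpha \<sigma> (w_disc n w)\<close> with \<^term>\<open>alpha \<sigma> w\<close> is needed.\<close>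

lemma one_plus_eta:
  assumes s: "\<sigma> > 0" and "disc_mass n \<sigma> w k \<noteq> 0"
  shows "1 + eta n \<sigma> w = 2 * pi * alpha \<sigma> (w_disc n w) / disc_mass n \<sigma> w k"
proof -
  have a: "alpha \<sigma> (w_disc n w) > 0"
    using alpha_pos[OF s] w w_disc_bounds(1) by simp
  have sum: "(\<Sum>l\<in>neighbours n w j. weight n \<sigma> w j l) = disc_mass n \<sigma> w k / (2 * pi * alpha \<sigma> (w_disc n w))" for j
    unfolding disc_mass_translate[OF n_pos w, of \<sigma> k j]
    by (simp add: weight_def disc_mass_def sum_divide_distrib)
  have "eta n \<sigma> w = 2 * pi * alpha \<sigma> (w_disc n w) / disc_mass n \<sigma> w k - 1"
    unfolding eta_def sum
  proof (rule the_equality)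
    fix \<eta>
    assume "\<forall>k'\<in>grid n. sq_ball (w_disc n w) (node n k') \<subseteq> Omega \<longrightarrow>
      (1 + \<eta>) * (disc_mass n \<sigma> w k / (2 * pi * alpha \<sigma> (w_disc n w))) = 1"
    \<comment> \<open>Uniqueness: the central node keeps the condition from being vacuous, and one
      instance of it determines \<open>\<eta>\<close>.\<close>
    then have "(1 + \<eta>) * (disc_mass n \<sigma> w k / (2 * pi * alpha \<sigma> (w_disc n w))) = 1"
      using centre_in_grid sq_ball_w_disc_centre by blast
    then show "\<eta> = 2 * pi * alpha \<sigma> (w_disc n w) / disc_mass n \<sigma> w k - 1"
      using a assms(2) by (simp add: field_simps)
  qed (use a assms(2) in simp)
  then show ?thesis by simp
qed

lemma blur_disc_step:
  assumes s: "\<sigma> > 0" and S: "disc_mass n \<sigma> w k \<noteq> 0" and u: "u \<in> step_space n"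
    and x: "x \<in> cell n k \<inter> Omega"
  shows "blur_disc n \<sigma> w u x =
    (\<Sum>l\<in>grid n. u (node n l) * ((1 / real n)\<^sup>2 * disc_kernel n \<sigma> w k l)) / disc_mass n \<sigma> w k"
proof -
  have a: "alpha \<sigma> (w_disc n w) > 0"
    using alpha_pos[OF s] w w_disc_bounds(1) by simp
  \<comment> \<open>This cuts neighbourhoods that stick out of \<open>Omega\<close> down to the
    grid, while the normalization keeps the full \<open>disc_mass\<close>.\<close>
  have u0: "u (node n l) = 0" if "l \<notin> grid n" for l
    using that u node_in_Omega_iff[OF n_pos] by (auto simp: step_space_def)
  have "blur_disc n \<sigma> w u x = (1 + eta n \<sigma> w) * (\<Sum>l\<in>neighbours n w k. weight n \<sigma> w k l * u (node n l))"
    using x unfolding blur_disc_def step_fun_def sum_indicator_cell[OF n_pos] by (simp add: cell_iff[OF n_pos])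
  also have "(\<Sum>l\<in>neighbours n w k. weight n \<sigma> w k l * u (node n l)) =
      (\<Sum>l\<in>neighbours n w k. gauss \<sigma> (node n k - node n l) * ((1 / real n)\<^sup>2 * u (node n l))) / (2 * pi * alpha \<sigma> (w_disc n w))"
    by (simp add: weight_def sum_divide_distrib mult_ac)
  also have "(\<Sum>l\<in>neighbours n w k. gauss \<sigma> (node n k - node n l) * ((1 / real n)\<^sup>2 * u (node n l))) =
      (\<Sum>l\<in>grid n. disc_kernel n \<sigma> w k l * ((1 / real n)\<^sup>2 * u (node n l)))"
    using u0 by (intro sum_neighbours_grid[OF n_pos w]) auto
  also have "\<dots> = (\<Sum>l\<in>grid n. u (node n l) * ((1 / real n)\<^sup>2 * disc_kernel n \<sigma> w k l))"
    by (simp only: mult_ac)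
  finally show ?thesis
    using a by (simp add: one_plus_eta[OF s S])
qed

end

section \<open>Error of the normalized kernels and the two estimates\<close>

lemma disc_mass_lower_bound:
  assumes w: "w > 0" and n: "2 \<le> (1 / 2 - w) * real n" and s: "\<sigma> > 0"
    and a: "a = 2 * pi * alpha \<sigma> w" and nc: "2 * (4 / \<sigma> ^ 4 + 20 / \<sigma>\<^sup>2) / a \<le> real n"
  shows "a / 2 \<le> disc_mass n \<sigma> w k"
proof -
  have a0: "a > 0" using alpha_pos[OF s w] by (simp add: a)
  \<comment> \<open>The purpose of the lower bound on \<open>n\<close>: the quadrature error takes
    away at most half of \<open>a\<close>.\<close>
  have "(4 / \<sigma> ^ 4 + 20 / \<sigma>\<^sup>2) * (1 / real n) \<le> a / 2"
    using nc n_pos[OF w n refl] a0 by (simp add: pos_divide_le_eq mult_ac)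
  then show ?thesis
    using disc_mass_approx[OF w n refl s, of k] unfolding a by linarith
qed

text \<open>The bound depends on \<open>x\<close> only through its cell, which turns the L2 estimate
  into a matrix inequality. Its second summand is the price of the two normalizations: an entry of
  size at most \<open>1 / \<sigma>\<^sup>2\<close> times the difference of reciprocals, at most c h
  / (a * a/2).\<close>

lemma blur_diff_pointwise:
  assumes w: "w > 0" and n: "2 \<le> (1 / 2 - w) * real n" and s: "\<sigma> > 0"
    and a: "a = 2 * pi * alpha \<sigma> w" and c: "c = 4 / \<sigma> ^ 4 + 20 / \<sigma>\<^sup>2" and nc: "2 * c / a \<le> real n"
    and u: "u \<in> step_space n" and k: "k \<in> grid n" and x: "x \<in> cell n k \<inter> Omega"
  shows "\<bar>blur \<sigma> w u x - blur_disc n \<sigma> w u x\<bar> \<le> (\<Sum>l\<in>grid n.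
      (1 / real n)\<^sup>2 * (kernel_err n \<sigma> w k l / a + 2 * c / (\<sigma>\<^sup>2 * a\<^sup>2) * (1 / real n)) * \<bar>u (node n l)\<bar>)"
proof -
  note np = n_pos[OF w n refl]
  have a0: "a > 0" using alpha_pos[OF s w] by (simp add: a)
  have c0: "c > 0" using s by (simp add: c add_pos_pos)
  define S where "S = disc_mass n \<sigma> w k"
  have Sa: "\<bar>S - a\<bar> \<le> c * (1 / real n)"
    using disc_mass_approx[OF w n refl s] by (simp add: S_def a c)
  have S2: "a / 2 \<le> S"
    unfolding S_def by (rule disc_mass_lower_bound[OF w n s a nc[unfolded c]])
  then have S0: "S > 0" using a0 by simp
  let ?I = "cell_mass n \<sigma> w x" and ?J = "\<lambda>l. (1 / real n)\<^sup>2 * disc_kernel n \<sigma> w k l"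
  have b: "blur_disc n \<sigma> w u x = (\<Sum>l\<in>grid n. u (node n l) * ?J l) / S"
    using blur_disc_step[OF w n refl s _ u x] S0 by (simp add: S_def)
  have inv: "\<bar>1 / a - 1 / S\<bar> \<le> 2 * c / a\<^sup>2 * (1 / real n)"
  proof -
    have "\<bar>1 / a - 1 / S\<bar> = \<bar>S - a\<bar> / (a * S)"
      using a0 S0 by (simp add: diff_frac_eq abs_mult abs_divide)
    also have "\<dots> \<le> (c * (1 / real n)) / (a * (a / 2))"
      using Sa S2 a0 c0 by (intro frac_le mult_left_mono) auto
    finally show ?thesis by (simp add: power2_eq_square field_simps)
  qed
  have E: "\<bar>?I l / a - ?J l / S\<bar> \<le> (1 / real n)\<^sup>2 * (kernel_err n \<sigma> w k l / a + 2 * c / (\<sigma>\<^sup>2 * a\<^sup>2) * (1 / real n))"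
    if l: "l \<in> grid n" for l
  proof -
    have J: "0 \<le> disc_kernel n \<sigma> w k l" "disc_kernel n \<sigma> w k l \<le> 1 / \<sigma>\<^sup>2"
      by (rule disc_kernel_bounds[OF s])+
    \<comment> \<open>Splits off the change of normalization, so that the kernel error is divided by
      the fixed constant \<open>a\<close> alone.\<close>
    have "?I l / a - ?J l / S = (?I l - ?J l) / a + ?J l * (1 / a - 1 / S)"
      by (simp add: diff_divide_distrib right_diff_distrib)
    then have "\<bar>?I l / a - ?J l / S\<bar> \<le> \<bar>(?I l - ?J l) / a\<bar> + \<bar>?J l * (1 / a - 1 / S)\<bar>"
      by (simp only: abs_triangle_ineq)
    also have "\<bar>(?I l - ?J l) / a\<bar> \<le> (1 / real n)\<^sup>2 * kernel_err n \<sigma> w k l / a"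
      using cell_mass_approx[OF np w s k l x] a0 by (simp add: abs_divide divide_right_mono)
    also have "\<bar>?J l * (1 / a - 1 / S)\<bar> = ?J l * \<bar>1 / a - 1 / S\<bar>"
      using J(1) by (simp add: abs_mult)
    also have "\<dots> \<le> ((1 / real n)\<^sup>2 * (1 / \<sigma>\<^sup>2)) * (2 * c / a\<^sup>2 * (1 / real n))"
      using J inv by (intro mult_mono) auto
    finally show ?thesis by (simp add: algebra_simps)
  qed
  have "blur \<sigma> w u x - blur_disc n \<sigma> w u x = (\<Sum>l\<in>grid n. (?I l / a - ?J l / S) * u (node n l))"
    unfolding blur_step[OF np s u] b a[symmetric]
    by (simp add: sum_divide_distrib sum_subtractf[symmetric] algebra_simps)
  then show "\<bar>blur \<sigma> w u x - blur_disc n \<sigma> w u x\<bar> \<le> (\<Sum>l\<in>grid n.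
      (1 / real n)\<^sup>2 * (kernel_err n \<sigma> w k l / a + 2 * c / (\<sigma>\<^sup>2 * a\<^sup>2) * (1 / real n)) * \<bar>u (node n l)\<bar>)"
    by (auto simp only: abs_mult intro!: order_trans[OF sum_abs] sum_mono mult_right_mono E)
qed

theorem theoremA4:
  fixes \<sigma> w :: real
  assumes "\<sigma> > 0" and "0 < w" and "w < 1 / 2"
  shows "\<exists>C>0. \<forall>\<^sub>F n in sequentially.
    (\<forall>u\<in>step_space n.
       L2_norm_Omega (\<lambda>x. blur \<sigma> w u x - blur_disc n \<sigma> w u x) \<le> C * (1 / real n) * L2_norm_Omega u) \<and>
    (\<forall>u\<in>step_space n.
       Linf_norm_Omega (blur_disc n \<sigma> w u) \<le> ereal (C * L2_norm_Omega u))"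
proof -
  define a where "a = 2 * pi * alpha \<sigma> w"
  define c where "c = 4 / \<sigma> ^ 4 + 20 / \<sigma>\<^sup>2"
  \<comment> \<open>The row sums of the bound in \<open>blur_diff_pointwise\<close>, divided by
    h.\<close>
  define C1 where "C1 = c / a + 2 * c / (\<sigma>\<^sup>2 * a\<^sup>2)"
  \<comment> \<open>The maximum of the Gaussian over the lower bound \<open>a / 2\<close> of
    \<open>disc_mass\<close>; the root undoes the normalization of the measure.\<close>
  define C2 where "C2 = 2 / (\<sigma>\<^sup>2 * a) * sqrt (2 * pi)"
  have a0: "a > 0" using alpha_pos[OF assms(1,2)] by (simp add: a_def)
  have c0: "c > 0" using assms by (simp add: c_def add_pos_pos)
  have C0: "C1 > 0" "C2 > 0"
    using a0 c0 assms by (simp_all add: C1_def C2_def add_pos_pos)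
  \<comment> \<open>The first condition provides the central node, the second the lower bound on
    \<open>disc_mass\<close>.\<close>
  have "eventually (\<lambda>n. 2 \<le> (1 / 2 - w) * real n \<and> 2 * c / a \<le> real n) sequentially"
  proof (rule eventually_sequentiallyI)
    fix n assume "nat \<lceil>max (2 / (1 / 2 - w)) (2 * c / a)\<rceil> \<le> n"
    then have "max (2 / (1 / 2 - w)) (2 * c / a) \<le> real n" by linarith
    then show "2 \<le> (1 / 2 - w) * real n \<and> 2 * c / a \<le> real n"
      using assms by (auto simp: divide_le_eq mult.commute)
  qed
  then have "\<forall>\<^sub>F n in sequentially.
    (\<forall>u\<in>step_space n.
       L2_norm_Omega (\<lambda>x. blur \<sigma> w u x - blur_disc n \<sigma> w u x) \<le> (C1 + C2) * (1 / real n) * L2_norm_Omega u) \<and>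
    (\<forall>u\<in>step_space n.
       Linf_norm_Omega (blur_disc n \<sigma> w u) \<le> ereal ((C1 + C2) * L2_norm_Omega u))"
  proof (rule eventually_mono, safe)
    fix n u
    assume n: "2 \<le> (1 / 2 - w) * real n" and nc: "2 * c / a \<le> real n" and u: "u \<in> step_space n"
    note pw = blur_diff_pointwise[OF assms(2) n assms(1) a_def c_def nc u]
    note np = n_pos[OF assms(2) n refl]
    define N where "N = (\<Sum>l\<in>grid n. (1 / real n)\<^sup>2 * (u (node n l))\<^sup>2)"
    have L2u: "L2_norm_Omega u = sqrt (1 / (2 * pi) * N)"
      unfolding N_def by (rule L2_norm_step[OF np u])
    have N0: "N \<ge> 0" by (simp add: N_def sum_nonneg)
    have L0: "L2_norm_Omega u \<ge> 0" using N0 by (simp add: L2u)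
    define K where "K k l = (1 / real n)\<^sup>2 * (kernel_err n \<sigma> w k l / a + 2 * c / (\<sigma>\<^sup>2 * a\<^sup>2) * (1 / real n))" for k l
    have Knonneg: "0 \<le> K k l" for k l
      using a0 c0 kernel_err_nonneg[OF assms(1)] by (simp add: K_def)
    have Kcomm: "K k l = K l k" for k l
      by (simp add: K_def kernel_err_commute)
    \<comment> \<open>By symmetry the row bound below also serves as the column bound of the Schur
      test.\<close>
    have col: "(\<Sum>k\<in>grid n. K k l) = (\<Sum>k\<in>grid n. K l k)" for l
      by (intro sum.cong refl Kcomm)
    have row: "(\<Sum>l\<in>grid n. K k l) \<le> C1 * (1 / real n)" for k
    proof -
      have "(\<Sum>l\<in>grid n. K k l) = (\<Sum>l\<in>grid n. (1 / real n)\<^sup>2 * kernel_err n \<sigma> w k l) / a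
          + real (card (grid n)) * ((1 / real n)\<^sup>2 * (2 * c / (\<sigma>\<^sup>2 * a\<^sup>2) * (1 / real n)))"
        by (simp add: K_def distrib_left sum.distrib sum_divide_distrib)
      also have "\<dots> \<le> c * (1 / real n) / a + 2 * c / (\<sigma>\<^sup>2 * a\<^sup>2) * (1 / real n)"
        using sum_kernel_err[OF np assms(1), of w k] a0 np
        by (intro add_mono divide_right_mono) (auto simp: c_def card_grid power_divide)
      finally show ?thesis by (simp add: C1_def algebra_simps)
    qed
    {
      have "L2_norm_Omega (\<lambda>x. blur \<sigma> w u x - blur_disc n \<sigma> w u x)
          \<le> sqrt (1 / (2 * pi) * (\<Sum>k\<in>grid n. (1 / real n)\<^sup>2 * (\<Sum>l\<in>grid n. K k l * \<bar>u (node n l)\<bar>)\<^sup>2))"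
      proof (rule L2_norm_le_step[OF np])
        fix k x assume "k \<in> grid n" "x \<in> cell n k \<inter> Omega"
        then have "\<bar>blur \<sigma> w u x - blur_disc n \<sigma> w u x\<bar> \<le> (\<Sum>l\<in>grid n. K k l * \<bar>u (node n l)\<bar>)"
          unfolding K_def by (rule pw)
        then show "(blur \<sigma> w u x - blur_disc n \<sigma> w u x)\<^sup>2 \<le> (\<Sum>l\<in>grid n. K k l * \<bar>u (node n l)\<bar>)\<^sup>2"
          by (rule power2_le_iff_abs_le[THEN iffD2, rotated]) (simp add: sum_nonneg Knonneg)
      qed
      also have "\<dots> \<le> sqrt (1 / (2 * pi) * ((C1 * (1 / real n))\<^sup>2 * N))"
      proof (intro real_sqrt_le_mono mult_left_mono)
        have "(\<Sum>k\<in>grid n. (\<Sum>l\<in>grid n. K k l * \<bar>u (node n l)\<bar>)\<^sup>2) \<le> (C1 * (1 / real n))\<^sup>2 * (\<Sum>l\<in>grid n. \<bar>u (node n l)\<bar>\<^sup>2)"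
          using row C0 by (intro schur_test Knonneg) (simp_all add: col)
        then have "(1 / real n)\<^sup>2 * (\<Sum>k\<in>grid n. (\<Sum>l\<in>grid n. K k l * \<bar>u (node n l)\<bar>)\<^sup>2)
            \<le> (1 / real n)\<^sup>2 * ((C1 * (1 / real n))\<^sup>2 * (\<Sum>l\<in>grid n. \<bar>u (node n l)\<bar>\<^sup>2))"
          by (intro mult_left_mono) auto
        then show "(\<Sum>k\<in>grid n. (1 / real n)\<^sup>2 * (\<Sum>l\<in>grid n. K k l * \<bar>u (node n l)\<bar>)\<^sup>2) \<le> (C1 * (1 / real n))\<^sup>2 * N"
          by (simp only: N_def power2_abs sum_distrib_left mult_ac)
      qed auto
      also have "\<dots> = C1 * (1 / real n) * L2_norm_Omega u"
        unfolding L2u using C0 by (simp add: real_sqrt_mult real_sqrt_divide)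
      also have "\<dots> \<le> (C1 + C2) * (1 / real n) * L2_norm_Omega u"
        using C0 L0 by (intro mult_right_mono) auto
      finally show "L2_norm_Omega (\<lambda>x. blur \<sigma> w u x - blur_disc n \<sigma> w u x) \<le> (C1 + C2) * (1 / real n) * L2_norm_Omega u" .
    next
      have bound: "\<bar>blur_disc n \<sigma> w u x\<bar> \<le> C2 * L2_norm_Omega u" if x: "x \<in> Omega" for x
      proof -
        define k where "k = (\<lfloor>real n * x $ 1\<rfloor>, \<lfloor>real n * x $ 2\<rfloor>)"
        have k: "k \<in> grid n" "x \<in> cell n k \<inter> Omega"
          using x Omega_imp_grid[OF np x] by (auto simp: k_def cell_iff[OF np])
        have S: "a / 2 \<le> disc_mass n \<sigma> w k"
          by (rule disc_mass_lower_bound[OF assms(2) n assms(1) a_def nc[unfolded c_def]])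
        \<comment> \<open>The area h^2 is shared evenly between the two factors: the first then sums
          to 1, the area of \<open>Omega\<close>, and the second to \<open>N\<close>.\<close>
        have "(\<Sum>l\<in>grid n. (1 / real n) * ((1 / real n) * \<bar>u (node n l)\<bar>))\<^sup>2
            \<le> (\<Sum>l\<in>grid n. (1 / real n)\<^sup>2) * (\<Sum>l\<in>grid n. ((1 / real n) * \<bar>u (node n l)\<bar>)\<^sup>2)"
          by (rule Cauchy_Schwarz_ineq_sum)
        also have "\<dots> = N"
          using np by (simp add: N_def card_grid power_divide power_mult_distrib)
        finally have CS: "(\<Sum>l\<in>grid n. (1 / real n) * ((1 / real n) * \<bar>u (node n l)\<bar>)) \<le> sqrt N"
          by (rule real_le_rsqrt)
        have "\<bar>blur_disc n \<sigma> w u x\<bar> = \<bar>\<Sum>l\<in>grid n. u (node n l) * ((1 / real n)\<^sup>2 * disc_kernel n \<sigma> w k l)\<bar> / disc_mass n \<sigma> w k"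
          using S a0 blur_disc_step[OF assms(2) n refl assms(1) _ u k(2)] by simp
        also have "\<dots> \<le> (1 / \<sigma>\<^sup>2 * sqrt N) / (a / 2)"
        proof (rule frac_le)
          have "\<bar>\<Sum>l\<in>grid n. u (node n l) * ((1 / real n)\<^sup>2 * disc_kernel n \<sigma> w k l)\<bar>
              \<le> (\<Sum>l\<in>grid n. \<bar>u (node n l)\<bar> * ((1 / real n)\<^sup>2 * (1 / \<sigma>\<^sup>2)))"
            by (intro order_trans[OF sum_abs] sum_mono)
               (simp add: abs_mult disc_kernel_bounds[OF assms(1)] mult_left_mono divide_right_mono
                 del: times_divide_eq_right)
          also have "\<dots> = 1 / \<sigma>\<^sup>2 * (\<Sum>l\<in>grid n. (1 / real n) * ((1 / real n) * \<bar>u (node n l)\<bar>))"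
            by (simp only: sum_distrib_left power2_eq_square mult_ac)
          also have "\<dots> \<le> 1 / \<sigma>\<^sup>2 * sqrt N"
            using CS by (intro mult_left_mono) auto
          finally show "\<bar>\<Sum>l\<in>grid n. u (node n l) * ((1 / real n)\<^sup>2 * disc_kernel n \<sigma> w k l)\<bar> \<le> 1 / \<sigma>\<^sup>2 * sqrt N" .
        qed (use a0 S N0 in auto)
        also have "\<dots> = C2 * L2_norm_Omega u"
          by (simp add: C2_def L2u real_sqrt_mult real_sqrt_divide field_simps)
        finally show ?thesis .
      qed
      have "C2 * L2_norm_Omega u \<le> (C1 + C2) * L2_norm_Omega u"
        using C0 L0 by (intro mult_right_mono) auto
      then have "AE x in restrict_space lborel Omega. ereal \<bar>blur_disc n \<sigma> w u x\<bar> \<le> ereal ((C1 + C2) * L2_norm_Omega u)"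
        using bound by (intro AE_I2) (force simp: space_restrict_space)
      \<comment> \<open>The essential supremum of a non-measurable function is infinite by
        convention, so measurability is part of the claim.\<close>
      moreover have "(\<lambda>x. ereal \<bar>blur_disc n \<sigma> w u x\<bar>) \<in> borel_measurable (restrict_space lborel Omega)"
        unfolding blur_disc_def step_fun_def by (rule measurable_restrict_space1) measurable
      ultimately show "Linf_norm_Omega (blur_disc n \<sigma> w u) \<le> ereal ((C1 + C2) * L2_norm_Omega u)"
        unfolding Linf_norm_Omega_def by (intro esssup_I)
    }
  qed
  then show ?thesis
    using C0 by (intro exI[of _ "C1 + C2"]) auto
qed

end
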